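(* Let $0<q<1$, $N\in\mathbb{Z}_{>0}$, and let $a,b$ be real with either $0<a<1$ and $b<1$, or $a,b>q^{1-N}$. Then for all $n,x\in\{0,1,\ldots,N\}$ $$Q_n^{a,b,N;q}(x)=\sum_{k=0}^{\min(n,x)}q^{\frac12(n-k)(n-k-1)}\,(-a)^{n-k}\,\frac{(bq^k;q)_{n-k}\,(abq^{n-1};q)_k}{(a;q)_n\,(q;q)_k}\,\frac{(q^n;q^{-1})_k\,(q^x;q^{-1})_k}{(q^N;q^{-1})_k}.$$
   Context: For $k\in\mathbb{Z}_{\ge0}$ write $(c;q)_k:=\prod_{i=0}^{k-1}(1-cq^i)$ and correspondingly $(c;q^{-1})_k:=\prod_{i=0}^{k-1}(1-cq^{-i})$. The (reparametrized) $q$-Hahn polynomials are, for $n,x\in\{0,1,\ldots,N\}$, $$Q_n^{a,b,N;q}(x):={}_3\phi_2\left(q^{-n},abq^{n-1},q^{x-N};a,q^{-N};q,q\right)=\sum_{k=0}^n\frac{(q^{-n};q)_k\,(abq^{n-1};q)_k\,(q^{x-N};q)_k}{(a;q)_k\,(q^{-N};q)_k\,(q;q)_k}\,q^k.$$ *)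

theory Defs
  imports Complex_Main
begin

text \<open>The finite q-shifted factorial \<open>(c;p)\<^sub>k\<close>. The variant \<open>(c;q\<^sup>-\<^sup>1)\<^sub>k\<close> is
  obtained by taking \<open>p = 1 / q\<close>.\<close>

definition qpoch :: "real \<Rightarrow> real \<Rightarrow> nat \<Rightarrow> real" where
  "qpoch c p k = (\<Prod>i<k. 1 - c * p ^ i)"

text \<open>The reparametrized q-Hahn polynomial, as the terminating \<open>\<^sub>3\<phi>\<^sub>2\<close> sum. Exponents of \<open>q\<close> that
  may be negative (including \<open>n - 1\<close> for \<open>n = 0\<close>) are integers.\<close>

definition q_Hahn :: "real \<Rightarrow> real \<Rightarrow> nat \<Rightarrow> real \<Rightarrow> nat \<Rightarrow> nat \<Rightarrow> real" where
  "q_Hahn a b N q n x =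
     (\<Sum>k=0..n.
        (qpoch (q powi (- int n)) q k * qpoch (a * b * q powi (int n - 1)) q k
           * qpoch (q powi (int x - int N)) q k)
        / (qpoch a q k * qpoch (q powi (- int N)) q k * qpoch q q k) * q ^ k)"

end

(* Everything rests on the homogeneous q-Vandermonde identity
     h(x,z)_k = sum_j [k choose j] h(x,y)_j h(y,z)_(k-j),   h(x,y)_k = prod_(i<k) (x - y t^i),
   in base t = 1/q. With (x,y,z) = (1, B, BX), B = q^(k-1-N), it expands (q^(x-N);q)_k in the basis
   (X;1/q)_j, X = q^x. After interchanging the sums, the coefficient of (X;1/q)_j is a terminating
   2phi1 at argument q, which the same identity with (x,y,z) = (u, 1, c q^(p-1)) evaluates
   (q-Chu-Vandermonde). *)

theory Submission
  imports Defs
begin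

section \<open>Shifted factorials and Gaussian binomial coefficients\<close>

lemma qpoch_0 [simp]: "qpoch c q 0 = 1"
  by (simp add: qpoch_def)

lemma qpoch_Suc: "qpoch c q (Suc k) = qpoch c q k * (1 - c * q ^ k)"
  by (simp add: qpoch_def)

lemma qpoch_add: "qpoch c q (j + m) = qpoch c q j * qpoch (c * q ^ j) q m"
  by (induction m) (simp_all add: qpoch_Suc power_add mult_ac)

lemma qpoch_nonzero:
  assumes "\<And>i. i < k \<Longrightarrow> c * q ^ i \<noteq> 1"
  shows "qpoch c q k \<noteq> 0"
  using assms by (force simp: qpoch_def)

text \<open>The q-binomial coefficient in base \<open>t\<close>, given by the q-Pascal rule: being
  free of division, it makes \<open>hpoch_vandermonde\<close> valid for every
  \<open>t\<close>.\<close>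

fun gauss_binomial :: "real \<Rightarrow> nat \<Rightarrow> nat \<Rightarrow> real" where
  "gauss_binomial t n 0 = 1"
| "gauss_binomial t 0 (Suc k) = 0"
| "gauss_binomial t (Suc n) (Suc k) = gauss_binomial t n k + t ^ Suc k * gauss_binomial t n (Suc k)"

lemma gauss_binomial_eq_0: "n < k \<Longrightarrow> gauss_binomial t n k = 0"
  by (induction t n k rule: gauss_binomial.induct) auto

lemma gauss_binomial_self [simp]: "gauss_binomial t n n = 1"
  by (induction n) (auto simp: gauss_binomial_eq_0)

text \<open>In base q the binomial is (q;q)_(j+m) / ((q;q)_j (q;q)_m); passing to base 1/q costs the
  factor q^(jm). By the Pascal rule, induction on j + m comes down to q^m (1 - q^j) + (1 - q^m) = 1
  - q^(j+m).\<close>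

lemma gauss_binomial_inverse_base:
  assumes "q \<noteq> 0"
  shows "gauss_binomial (1 / q) (j + m) j * q ^ (j * m) * qpoch q q j * qpoch q q m = qpoch q q (j + m)"
proof (induction "j + m" arbitrary: j m)
  case 0
  then show ?case by simp
next
  case (Suc s)
  show ?case
  proof (cases "j = 0 \<or> m = 0")
    case True
    then show ?thesis by auto
  next
    case False
    then obtain j' m' where jm: "j = Suc j'" "m = Suc m'"
      by (metis not0_implies_Suc)
    let ?G = "gauss_binomial (1 / q)"
    have 1: "?G (j' + Suc m') j' * q ^ (j' * Suc m') * qpoch q q j' * qpoch q q (Suc m') = qpoch q q s"
      using Suc.hyps(1)[of j' "Suc m'"] Suc.hyps(2) jm by simp
    have 2: "?G (Suc j' + m') (Suc j') * q ^ (Suc j' * m') * qpoch q q (Suc j') * qpoch q q m' = qpoch q q s"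
      using Suc.hyps(1)[of "Suc j'" m'] Suc.hyps(2) jm by simp
    have G: "?G (j + m) j = ?G (j' + Suc m') j' + (1 / q) ^ Suc j' * ?G (Suc j' + m') (Suc j')"
      using jm by simp
    have P: "q ^ (j * m) = q ^ (j' * Suc m') * q ^ Suc m'" "(1 / q) ^ Suc j' * q ^ (j * m) = q ^ (Suc j' * m')"
      using assms jm by (simp_all add: power_add power_divide mult_ac)
    have "?G (j + m) j * q ^ (j * m) * qpoch q q j * qpoch q q m
      = ?G (j' + Suc m') j' * q ^ (j * m) * qpoch q q j * qpoch q q m
       + ?G (Suc j' + m') (Suc j') * ((1 / q) ^ Suc j' * q ^ (j * m)) * qpoch q q j * qpoch q q m"
      unfolding G by (simp only: algebra_simps)
    also have "\<dots> = (?G (j' + Suc m') j' * q ^ (j' * Suc m') * qpoch q q j' * qpoch q q (Suc m')) * (q ^ Suc m' * (1 - q * q ^ j'))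
       + (?G (Suc j' + m') (Suc j') * q ^ (Suc j' * m') * qpoch q q (Suc j') * qpoch q q m') * (1 - q * q ^ m')"
      unfolding P(2) unfolding P(1) unfolding jm qpoch_Suc[of _ _ j'] qpoch_Suc[of _ _ m'] by (simp only: mult_ac)
    also have "\<dots> = qpoch q q s * (1 - q * q ^ s)"
      unfolding 1 2 using jm Suc.hyps(2) by (auto simp: algebra_simps power_add)
    finally show ?thesis
      unfolding Suc.hyps(2)[symmetric] by (simp only: qpoch_Suc)
  qed
qed

section \<open>Homogeneous shifted factorials and the q-Vandermonde identity\<close>

text \<open>For nonzero x this is x^k (y/x;t)_k; the homogeneous form also admits x = 0.\<close>

definition hpoch :: "real \<Rightarrow> real \<Rightarrow> real \<Rightarrow> nat \<Rightarrow> real" where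
  "hpoch t x y k = (\<Prod>i<k. x - y * t ^ i)"

lemma hpoch_0 [simp]: "hpoch t x y 0 = 1"
  by (simp add: hpoch_def)

lemma hpoch_Suc: "hpoch t x y (Suc k) = hpoch t x y k * (x - y * t ^ k)"
  by (simp add: hpoch_def)

lemma hpoch_one_left: "hpoch t 1 y k = qpoch y t k"
  by (simp add: hpoch_def qpoch_def)

lemma hpoch_scale: "hpoch t c (c * y) k = c ^ k * qpoch y t k"
  by (induction k) (simp_all add: hpoch_Suc qpoch_Suc algebra_simps)

text \<open>Replacing i by k - 1 - i turns q^i into q^(k-1) (1/q)^i. For k = 0 both products are
  empty, so the truncated \<open>k - 1\<close> is harmless.\<close>

lemma hpoch_reverse:
  assumes "q \<noteq> 0"
  shows "hpoch (1 / q) x (y * q ^ (k - 1)) k = hpoch q x y k"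
proof -
  have "hpoch q x y k = (\<Prod>i<k. x - y * q ^ (k - Suc i))"
    unfolding hpoch_def by (rule prod.nat_diff_reindex[symmetric])
  also have "\<dots> = hpoch (1 / q) x (y * q ^ (k - 1)) k"
    unfolding hpoch_def using assms
    by (intro prod.cong refl) (simp add: power_diff power_divide)
  finally show ?thesis ..
qed

text \<open>With k = j + m the new factor splits as x - z t^k = (x - y t^j) + t^j (y - z t^m), and
  the two parts lengthen the first and the second product respectively.\<close>

lemma hpoch_vandermonde:
  "hpoch t x z k = (\<Sum>j\<le>k. gauss_binomial t k j * hpoch t x y j * hpoch t y z (k - j))"
proof (induction k)
  case 0
  then show ?case by simp
next
  case (Suc k)
  let ?G = "gauss_binomial t"
  let ?T = "\<lambda>j. ?G k j * t ^ j * hpoch t x y j * hpoch t y z (Suc k - j)"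
  have "hpoch t x z (Suc k)
    = (\<Sum>j\<le>k. ?G k j * hpoch t x y j * hpoch t y z (k - j) * (x - z * t ^ k))"
    by (simp add: hpoch_Suc Suc.IH sum_distrib_right)
  also have "\<dots> = (\<Sum>j\<le>k. ?G k j * hpoch t x y (Suc j) * hpoch t y z (k - j) + ?T j)"
  proof (intro sum.cong refl)
    fix j assume "j \<in> {..k}"
    then obtain m where k: "k = j + m" by (auto simp: le_iff_add)
    then show "?G k j * hpoch t x y j * hpoch t y z (k - j) * (x - z * t ^ k)
      = ?G k j * hpoch t x y (Suc j) * hpoch t y z (k - j) + ?T j"
      by (simp add: hpoch_Suc power_add Suc_diff_le algebra_simps)
  qed
  \<comment> \<open>The extra term j = k + 1 of the second sum is zero. With it, the first sum at j
    and the second at j + 1 combine by the q-Pascal rule.\<close>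
  also have "\<dots> = (\<Sum>j\<le>k. ?G k j * hpoch t x y (Suc j) * hpoch t y z (k - j)) + (\<Sum>j\<le>Suc k. ?T j)"
    by (simp add: sum.distrib gauss_binomial_eq_0)
  also have "\<dots> = (\<Sum>j\<le>Suc k. ?G (Suc k) j * hpoch t x y j * hpoch t y z (Suc k - j))"
    unfolding sum.atMost_Suc_shift[of _ k] by (simp add: sum.distrib algebra_simps)
  finally show ?case .
qed

text \<open>The basis (X;1/q)_j is chosen because at X = q^x it vanishes for j > x, which produces
  the cutoff min(n,x). In the application \<open>M\<close> is q^(-N).\<close>

lemma qpoch_expand_inverse_base:
  assumes "q \<noteq> 0"
  shows "qpoch (X * M) q k =
    (\<Sum>j\<le>k. gauss_binomial (1 / q) k (k - j) * (M * q ^ (k - 1)) ^ j * qpoch X (1 / q) j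
      * qpoch (M * q ^ j) q (k - j))"
proof -
  let ?t = "1 / q" and ?B = "M * q ^ (k - 1)"
  have "qpoch (X * M) q k = hpoch ?t 1 (?B * X) k"
    using hpoch_reverse[OF assms, of 1 "X * M" k] by (simp add: hpoch_one_left mult_ac)
  also have "\<dots> = (\<Sum>j\<le>k. gauss_binomial ?t k j * hpoch ?t 1 ?B j * hpoch ?t ?B (?B * X) (k - j))"
    by (rule hpoch_vandermonde)
  \<comment> \<open>After this reversal j is the degree in X.\<close>
  also have "\<dots> = (\<Sum>j\<le>k. gauss_binomial ?t k (k - j) * hpoch ?t 1 ?B (k - j) * hpoch ?t ?B (?B * X) j)"
    by (rule sum.reindex_bij_witness[of _ "\<lambda>j. k - j" "\<lambda>j. k - j"]) auto
  also have "\<dots> = (\<Sum>j\<le>k. gauss_binomial ?t k (k - j) * ?B ^ j * qpoch X ?t j * qpoch (M * q ^ j) q (k - j))"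
  proof (intro sum.cong refl)
    fix j assume "j \<in> {..k}"
    \<comment> \<open>The largest exponent in (M q^j;q)_(k-j) is j + (k-j-1) = k-1, the one in
      \<open>?B\<close>. For j = k, where truncation spoils this, the products are empty.\<close>
    have B: "hpoch ?t 1 ?B (k - j) = qpoch (M * q ^ j) q (k - j)"
    proof (cases "j < k")
      case True
      then have "q ^ (k - 1) = q ^ j * q ^ (k - j - 1)"
        by (simp flip: power_add)
      then show ?thesis
        using hpoch_reverse[OF assms, of 1 "M * q ^ j" "k - j"] by (simp add: hpoch_one_left mult_ac)
    qed simp
    show "gauss_binomial ?t k (k - j) * hpoch ?t 1 ?B (k - j) * hpoch ?t ?B (?B * X) j
      = gauss_binomial ?t k (k - j) * ?B ^ j * qpoch X ?t j * qpoch (M * q ^ j) q (k - j)"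
      unfolding B hpoch_scale by (simp only: mult_ac)
  qed
  finally show ?thesis .
qed

section \<open>The q-Chu-Vandermonde sum\<close>

lemma qpoch_self_nonzero:
  assumes "0 < q" "q < 1"
  shows "qpoch q q k \<noteq> 0"
proof (rule qpoch_nonzero)
  fix i :: nat
  have "q ^ Suc i < 1" by (rule power_Suc_less_one) (use assms in auto)
  then show "q * q ^ i \<noteq> 1" by simp
qed

text \<open>Turns a term of the q-Vandermonde sum with p = m + r into a term of a 2phi1 at argument
  q. Both sides change by the same factor when m grows and p stays fixed, so the induction
  hypothesis is used at \<open>Suc r\<close>.\<close>

lemma gauss_binomial_hpoch:
  assumes "0 < q" "q < 1"
  shows "gauss_binomial (1 / q) (m + r) m * hpoch (1 / q) u 1 m * qpoch q q m
    = qpoch ((1 / q) ^ (m + r)) q m * qpoch u q m * q ^ m"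
proof (induction m arbitrary: r)
  case 0
  then show ?case by simp
next
  case (Suc m)
  let ?G = "gauss_binomial (1 / q) (Suc m + r)"
  note nz = qpoch_self_nonzero[OF assms]
  have q0: "q \<noteq> 0" using assms by simp
  \<comment> \<open>Both sides equal (q;q)_p for p = m + 1 + r; cancelling common factors gives the
    ratio of adjacent binomials.\<close>
  have "?G (Suc m) * q ^ (Suc m * r) * qpoch q q (Suc m) * qpoch q q r
     = ?G m * q ^ (m * Suc r) * qpoch q q m * qpoch q q (Suc r)"
    using gauss_binomial_inverse_base[OF q0, of "Suc m" r] gauss_binomial_inverse_base[OF q0, of m "Suc r"]
    by simp
  then have "(q ^ (m * r) * qpoch q q m * qpoch q q r) * (?G (Suc m) * q ^ r * (1 - q * q ^ m))
     = (q ^ (m * r) * qpoch q q m * qpoch q q r) * (?G m * q ^ m * (1 - q * q ^ r))"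
    by (simp add: qpoch_Suc power_add mult_ac)
  then have ratio: "?G (Suc m) * q ^ r * (1 - q * q ^ m) = ?G m * q ^ m * (1 - q * q ^ r)"
    using nz q0 by simp
  \<comment> \<open>\<open>?K\<close> is q^(-p). Now 1 - q^(r+1) = -q^(r+1) (1 - q^(m-p)) and u -
    q^(-m) = -q^(-m) (1 - u q^m); the two signs cancel in \<open>factor\<close>.\<close>
  let ?K = "(1 / q) ^ (Suc m + r)"
  have K: "?K * q ^ m * (q ^ r * q) = 1"
    using q0 by (simp add: power_add power_divide)
  have "q ^ m * (u - (1 / q) ^ m) = u * q ^ m - 1"
    using q0 by (simp add: power_divide right_diff_distrib)
  then have "q ^ m * (1 - q * q ^ r) * (u - (1 / q) ^ m) = (q ^ r * q - ?K * q ^ m * (q ^ r * q)) * (1 - u * q ^ m)"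
    unfolding K by (simp add: algebra_simps)
  also have "\<dots> = q ^ r * ((1 - ?K * q ^ m) * (1 - u * q ^ m) * q)"
    by (simp only: algebra_simps)
  finally have factor: "q ^ m * (1 - q * q ^ r) * (u - (1 / q) ^ m)
    = q ^ r * ((1 - ?K * q ^ m) * (1 - u * q ^ m) * q)" .
  have "q ^ r * (?G (Suc m) * hpoch (1 / q) u 1 (Suc m) * qpoch q q (Suc m))
    = (?G (Suc m) * q ^ r * (1 - q * q ^ m)) * (u - (1 / q) ^ m) * (hpoch (1 / q) u 1 m * qpoch q q m)"
    by (simp add: hpoch_Suc qpoch_Suc mult_ac)
  also have "\<dots> = (?G m * hpoch (1 / q) u 1 m * qpoch q q m) * (q ^ m * (1 - q * q ^ r) * (u - (1 / q) ^ m))"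
    unfolding ratio by (simp only: mult_ac)
  also have "\<dots> = (qpoch ((1 / q) ^ (Suc m + r)) q m * qpoch u q m * q ^ m)
      * (q ^ r * ((1 - (1 / q) ^ (Suc m + r) * q ^ m) * (1 - u * q ^ m) * q))"
    unfolding factor using Suc.IH[of "Suc r"] by simp
  also have "\<dots> = q ^ r * (qpoch ((1 / q) ^ (Suc m + r)) q (Suc m) * qpoch u q (Suc m) * q ^ Suc m)"
    by (simp only: qpoch_Suc power_Suc mult_ac)
  finally show ?case using q0 by simp
qed

text \<open>The usual right-hand side \<open>u\<^sup>p (c/u; q)\<^sub>p / (c; q)\<^sub>p\<close> is written
  with \<open>hpoch\<close>, so that \<open>u = 0\<close> is covered; this is needed when \<open>b = 0\<close>.\<close>

lemma q_chu_vandermonde: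
  assumes "0 < q" "q < 1" and nz: "qpoch c q p \<noteq> 0"
  shows "(\<Sum>m\<le>p. qpoch ((1 / q) ^ p) q m * qpoch u q m / (qpoch c q m * qpoch q q m) * q ^ m)
    = hpoch q u c p / qpoch c q p"
proof -
  have q0: "q \<noteq> 0" using assms by simp
  have "hpoch q u c p = hpoch (1 / q) u (c * q ^ (p - 1)) p"
    by (rule hpoch_reverse[OF q0, symmetric])
  also have "\<dots> = (\<Sum>m\<le>p. gauss_binomial (1 / q) p m * hpoch (1 / q) u 1 m
      * hpoch (1 / q) 1 (c * q ^ (p - 1)) (p - m))"
    by (rule hpoch_vandermonde)
  also have "\<dots> = (\<Sum>m\<le>p. qpoch ((1 / q) ^ p) q m * qpoch u q m / (qpoch c q m * qpoch q q m) * q ^ m)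
      * qpoch c q p"
    unfolding sum_distrib_right
  proof (intro sum.cong refl)
    fix m assume "m \<in> {..p}"
    then obtain r where p: "p = m + r" by (auto simp: le_iff_add)
    \<comment> \<open>Hence every denominator (c;q)_m is a factor of (c;q)_p and is nonzero.\<close>
    have c: "qpoch c q p = qpoch c q m * qpoch (c * q ^ m) q r"
      unfolding p by (rule qpoch_add)
    have "hpoch (1 / q) 1 (c * q ^ (p - 1)) r = qpoch (c * q ^ m) q r"
    proof (cases r)
      case (Suc r')
      then show ?thesis
        using hpoch_reverse[OF q0, of 1 "c * q ^ m" r] by (simp add: p hpoch_one_left power_add mult_ac)
    qed simp
    then have "gauss_binomial (1 / q) p m * hpoch (1 / q) u 1 m * hpoch (1 / q) 1 (c * q ^ (p - 1)) (p - m)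
      = (gauss_binomial (1 / q) p m * hpoch (1 / q) u 1 m * qpoch q q m) * qpoch (c * q ^ m) q r / qpoch q q m"
      using qpoch_self_nonzero[OF assms(1,2), of m] by (simp add: p)
    also have "\<dots> = (qpoch ((1 / q) ^ p) q m * qpoch u q m * q ^ m) * qpoch (c * q ^ m) q r / qpoch q q m"
      unfolding p gauss_binomial_hpoch[OF assms(1,2)] ..
    also have "\<dots> = qpoch ((1 / q) ^ p) q m * qpoch u q m / (qpoch c q m * qpoch q q m) * q ^ m * qpoch c q p"
      using nz unfolding c by simp
    finally show "gauss_binomial (1 / q) p m * hpoch (1 / q) u 1 m * hpoch (1 / q) 1 (c * q ^ (p - 1)) (p - m)
      = qpoch ((1 / q) ^ p) q m * qpoch u q m / (qpoch c q m * qpoch q q m) * q ^ m * qpoch c q p" .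
  qed
  finally show ?thesis using nz by simp
qed

section \<open>Powers of q and signs in the evaluated coefficients\<close>

lemma prod_power_lessThan: "(\<Prod>i<p. (q :: real) ^ i) = q ^ (p * (p - 1) div 2)"
proof -
  have "(\<Sum>i<p. i) = p * (p - 1) div 2"
    using Sum_Ico_nat[of 0 p] by (simp add: atLeast0LessThan)
  then show ?thesis by (simp flip: power_sum)
qed

text \<open>This is the numerator that q-Chu-Vandermonde yields for n = j + p. Its factor number i
  is -a q^(j+i) (1 - b q^j q^(p-1-i)), so the factors containing b run through (b q^j;q)_p
  backwards.\<close>

lemma hpoch_factor:
  assumes "q \<noteq> 0"
  shows "hpoch q (a * b * q powi (int (j + p) - 1) * q ^ j) (a * q ^ j) p
    = q ^ (j * p) * (q ^ (p * (p - 1) div 2) * (- a) ^ p * qpoch (b * q ^ j) q p)"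
proof -
  have "hpoch q (a * b * q powi (int (j + p) - 1) * q ^ j) (a * q ^ j) p
    = (\<Prod>i<p. q ^ j * q ^ i * (- a) * (1 - b * q ^ j * q ^ (p - Suc i)))"
    unfolding hpoch_def
  proof (intro prod.cong refl)
    fix i assume "i \<in> {..<p}"
    \<comment> \<open>Since i < p, the exponent is a sum of naturals and the integer power becomes a
      product of ordinary powers.\<close>
    then have "int (j + p) - 1 = int (i + (p - Suc i) + j)" by auto
    then have "q powi (int (j + p) - 1) = q ^ i * q ^ (p - Suc i) * q ^ j"
      by (simp only: power_int_of_nat power_add)
    then show "a * b * q powi (int (j + p) - 1) * q ^ j - a * q ^ j * q ^ i
      = q ^ j * q ^ i * (- a) * (1 - b * q ^ j * q ^ (p - Suc i))"
      by (simp add: algebra_simps)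
  qed
  also have "\<dots> = (q ^ j) ^ p * q ^ (p * (p - 1) div 2) * (- a) ^ p * (\<Prod>i<p. 1 - b * q ^ j * q ^ (p - Suc i))"
    by (simp only: prod.distrib prod_power_lessThan prod_constant card_lessThan)
  also have "(\<Prod>i<p. 1 - b * q ^ j * q ^ (p - Suc i)) = qpoch (b * q ^ j) q p"
    unfolding qpoch_def by (rule prod.nat_diff_reindex)
  finally show ?thesis by (simp add: power_mult mult_ac)
qed

text \<open>Factorwise, (1 - q^(i-n)) q^n = -q^i (1 - q^(n-i)). The sign and the triangular power do
  not depend on n, so they cancel in the quotient of the instances for n and N.\<close>

lemma qpoch_inverse_power:
  assumes "q \<noteq> 0"
  shows "qpoch ((1 / q) ^ n) q j * q ^ (n * j) = (- 1) ^ j * q ^ (j * (j - 1) div 2) * qpoch (q ^ n) (1 / q) j"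
proof -
  have "qpoch ((1 / q) ^ n) q j * q ^ (n * j) = (\<Prod>i<j. (1 - (1 / q) ^ n * q ^ i) * q ^ n)"
    by (simp add: qpoch_def prod.distrib power_mult)
  also have "\<dots> = (\<Prod>i<j. (- 1) * q ^ i * (1 - q ^ n * (1 / q) ^ i))"
    using assms by (intro prod.cong refl) (simp add: power_divide field_simps)
  also have "\<dots> = (- 1) ^ j * q ^ (j * (j - 1) div 2) * qpoch (q ^ n) (1 / q) j"
    by (simp only: qpoch_def prod.distrib prod_power_lessThan prod_constant card_lessThan)
  finally show ?thesis .
qed

text \<open>The factor with index x is 1 - q^x q^(-x) = 0.\<close>

lemma qpoch_power_inverse_base_eq_0:
  assumes "q \<noteq> 0" "x < k"
  shows "qpoch (q ^ x) (1 / q) k = 0"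
  using assms by (auto simp: qpoch_def power_divide intro!: bexI[of _ x])


section \<open>Interchange of the sums in the 3phi2 and evaluation of the coefficients\<close>

theorem mainTheorem7:
  fixes q a b :: real and N n x :: nat
  assumes "0 < q" and "q < 1"
    and "N > 0"
    and "(0 < a \<and> a < 1 \<and> b < 1) \<or> (a > q powi (1 - int N) \<and> b > q powi (1 - int N))"
    and "n \<le> N" and "x \<le> N"
  shows "q_Hahn a b N q n x =
    (\<Sum>k=0..min n x.
       q ^ ((n - k) * (n - k - 1) div 2) * (- a) ^ (n - k)
       * (qpoch (b * q ^ k) q (n - k) * qpoch (a * b * q powi (int n - 1)) q k
            / (qpoch a q n * qpoch q q k))
       * (qpoch (q ^ n) (1 / q) k * qpoch (q ^ x) (1 / q) k / qpoch (q ^ N) (1 / q) k))"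
proof -
  have q0: "q \<noteq> 0" using assms(1) by simp
  let ?t = "1 / q"
  define A M X where "A = a * b * q powi (int n - 1)" and "M = ?t ^ N" and "X = q ^ x"
  \<comment> \<open>If a < 1, then a q^i < 1. In the other case i \<le> N - 1, so a q^i \<ge> a
    q^(N-1) > 1.\<close>
  have a_nz: "qpoch a q n \<noteq> 0"
  proof (rule qpoch_nonzero)
    fix i assume "i < n"
    have qi: "0 < q ^ i" "q ^ i \<le> 1"
      using assms(1,2) by (auto intro: power_le_one)
    from assms(4) show "a * q ^ i \<noteq> 1"
    proof
      assume "0 < a \<and> a < 1 \<and> b < 1"
      then have "a * q ^ i < 1"
        using qi by (metis less_eq_real_def mult_left_le order_le_less_trans)
      then show ?thesis by simp
    next
      assume "a > q powi (1 - int N) \<and> b > q powi (1 - int N)"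
      moreover have "q powi (1 - int N) = 1 / q ^ (N - 1)"
      proof -
        have "1 - int N = - int (N - 1)" using assms(3) by simp
        then show ?thesis by (simp only: power_int_minus power_int_of_nat inverse_eq_divide)
      qed
      ultimately have a: "1 / q ^ (N - 1) < a" by simp
      then have "1 < a * q ^ (N - 1)"
        using assms(1) by (simp add: pos_divide_less_eq)
      moreover have "a > 0"
        using a assms(1) by (smt (verit) zero_less_divide_iff zero_less_power)
      moreover have "q ^ (N - 1) \<le> q ^ i"
        using \<open>i < n\<close> assms by (intro power_decreasing) auto
      ultimately have "a * q ^ i > 1"
        by (meson less_le_trans mult_le_cancel_left_pos)
      then show ?thesis by simp
    qed
  qed
  have M_nz: "qpoch M q k \<noteq> 0" if "k \<le> N" for k
  proof (rule qpoch_nonzero)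
    fix i assume "i < k"
    then have "q ^ N < q ^ i" using that assms by (intro power_strict_decreasing) auto
    then show "M * q ^ i \<noteq> 1" using q0 by (simp add: M_def power_divide)
  qed
  have q_nz: "qpoch q q k \<noteq> 0" for k by (rule qpoch_self_nonzero[OF assms(1,2)])
  have a_split: "qpoch a q n = qpoch a q j * qpoch (a * q ^ j) q (n - j)" if "j \<le> n" for j
    using qpoch_add[of a q j "n - j"] that by simp

  \<comment> \<open>With k = j + m, \<open>C j\<close> collects what depends on j alone, and
    \<open>I j m\<close> is term m of the 2phi1 with upper parameters q^(-(n-j)), A q^j, lower
    parameter a q^j and argument q.\<close>
  define C where "C j = qpoch (?t ^ n) q j * qpoch A q j * qpoch X ?t j
    / (qpoch a q j * qpoch M q j * qpoch q q j) * (M ^ j * q ^ (j * j))" for j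
  define I where "I j m = qpoch (?t ^ (n - j)) q m * qpoch (A * q ^ j) q m
    / (qpoch (a * q ^ j) q m * qpoch q q m) * q ^ m" for j m

  have summand: "qpoch (?t ^ n) q k * qpoch A q k * qpoch (X * M) q k
      / (qpoch a q k * qpoch M q k * qpoch q q k) * q ^ k = (\<Sum>j\<le>k. C j * I j (k - j))"
    if k: "k \<le> n" for k
  proof -
    have "qpoch (?t ^ n) q k * qpoch A q k * qpoch (X * M) q k / (qpoch a q k * qpoch M q k * qpoch q q k) * q ^ k
      = qpoch (?t ^ n) q k * qpoch A q k / (qpoch a q k * qpoch M q k * qpoch q q k) * q ^ k * qpoch (X * M) q k"
      by simp
    also have "\<dots> = (\<Sum>j\<le>k. qpoch (?t ^ n) q k * qpoch A q k / (qpoch a q k * qpoch M q k * qpoch q q k) * q ^ k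
          * (gauss_binomial ?t k (k - j) * (M * q ^ (k - 1)) ^ j * qpoch X ?t j * qpoch (M * q ^ j) q (k - j)))"
      unfolding qpoch_expand_inverse_base[OF q0, of X M k] by (rule sum_distrib_left)
    also have "\<dots> = (\<Sum>j\<le>k. C j * I j (k - j))"
    proof (intro sum.cong refl)
      fix j assume "j \<in> {..k}"
      then obtain m where km: "k = j + m" by (auto simp: le_iff_add)
      \<comment> \<open>The numerator (q;q)_k cancels the one in the denominator of the
        3phi2.\<close>
      have binom: "gauss_binomial ?t (j + m) m * q ^ (j * m) = qpoch q q (j + m) / (qpoch q q j * qpoch q q m)"
        using gauss_binomial_inverse_base[OF q0, of m j] q_nz by (simp add: field_simps)
      have cancel: "u / (v * qpoch q q (j + m)) * w * (qpoch q q (j + m) / d) = u / v * w * (1 / d)" for u v w d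
        using q_nz by simp
      \<comment> \<open>The exponents match by j(j+m-1) + j + m = j^2 + m + jm; the part q^(jm) is
        what \<open>binom\<close> absorbs.\<close>
      have pow: "(M * q ^ (j + m - 1)) ^ j * q ^ (j + m) = M ^ j * q ^ (j * j) * q ^ m * q ^ (j * m)"
      proof (cases j)
        case (Suc i)
        have "(j + m - 1) * j + (j + m) = j * j + m + j * m"
          unfolding Suc by (simp add: algebra_simps)
        note exponent = this
        have "(M * q ^ (j + m - 1)) ^ j * q ^ (j + m) = M ^ j * q ^ ((j + m - 1) * j + (j + m))"
          by (simp only: power_mult_distrib power_mult power_add mult.assoc)
        also have "\<dots> = M ^ j * q ^ (j * j) * q ^ m * q ^ (j * m)"
          unfolding exponent by (simp only: power_add mult.assoc)
        finally show ?thesis .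
      qed simp
      have "?t ^ n = ?t ^ (n - j) * ?t ^ j"
        using k km by (subst power_add[symmetric]) simp
      then have "?t ^ n * q ^ j = ?t ^ (n - j)"
        using q0 by (simp add: power_divide)
      then have t: "qpoch (?t ^ n) q (j + m) = qpoch (?t ^ n) q j * qpoch (?t ^ (n - j)) q m"
        by (simp add: qpoch_add)
      \<comment> \<open>Only (M;q)_j survives, which is free of m; this lowers the inner series from
        a 3phi2 to a 2phi1.\<close>
      have "qpoch M q (j + m) \<noteq> 0" using M_nz k km assms(5) by simp
      then have M: "qpoch (M * q ^ j) q m / qpoch M q (j + m) = 1 / qpoch M q j"
        by (simp add: qpoch_add)
      have "qpoch (?t ^ n) q k * qpoch A q k / (qpoch a q k * qpoch M q k * qpoch q q k) * q ^ k
          * (gauss_binomial ?t k (k - j) * (M * q ^ (k - 1)) ^ j * qpoch X ?t j * qpoch (M * q ^ j) q (k - j))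
        = qpoch (?t ^ n) q (j + m) * qpoch A q (j + m) / (qpoch a q (j + m) * qpoch q q (j + m))
          * ((M * q ^ (j + m - 1)) ^ j * q ^ (j + m)) * gauss_binomial ?t (j + m) m * qpoch X ?t j
          * (qpoch (M * q ^ j) q m / qpoch M q (j + m))"
        unfolding km diff_add_inverse by (simp only: divide_inverse inverse_mult_distrib mult_1_left mult_ac)
      also have "\<dots> = qpoch (?t ^ n) q (j + m) * qpoch A q (j + m) / (qpoch a q (j + m) * qpoch q q (j + m))
          * (M ^ j * q ^ (j * j) * q ^ m) * (gauss_binomial ?t (j + m) m * q ^ (j * m)) * qpoch X ?t j
          * (1 / qpoch M q j)"
        unfolding M pow by (simp only: mult_ac)
      also have "\<dots> = qpoch (?t ^ n) q (j + m) * qpoch A q (j + m) / qpoch a q (j + m)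
          * (M ^ j * q ^ (j * j) * q ^ m) * (1 / (qpoch q q j * qpoch q q m)) * qpoch X ?t j
          * (1 / qpoch M q j)"
        unfolding binom cancel ..
      also have "\<dots> = C j * I j m"
        unfolding t C_def I_def qpoch_add[of A] qpoch_add[of a] by (simp only: divide_inverse inverse_mult_distrib mult_1_left mult_ac)
      finally show "qpoch (?t ^ n) q k * qpoch A q k / (qpoch a q k * qpoch M q k * qpoch q q k) * q ^ k
          * (gauss_binomial ?t k (k - j) * (M * q ^ (k - 1)) ^ j * qpoch X ?t j * qpoch (M * q ^ j) q (k - j))
        = C j * I j (k - j)" by (simp add: km)
    qed
    finally show ?thesis .
  qed

  define R where "R k = q ^ ((n - k) * (n - k - 1) div 2) * (- a) ^ (n - k)
    * (qpoch (b * q ^ k) q (n - k) * qpoch A q k / (qpoch a q n * qpoch q q k))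
    * (qpoch (q ^ n) ?t k * qpoch X ?t k / qpoch (q ^ N) ?t k)" for k

  have inner: "(\<Sum>m\<le>n - j. C j * I j m) = R j" if j: "j \<le> n" for j
  proof -
    obtain p where n: "n = j + p" using j by (auto simp: le_iff_add)
    \<comment> \<open>\<open>S\<close> is the factor shared by (q^(-n);q)_j and (q^(-N);q)_j after
      the change of base.\<close>
    define S where "S = (- 1) ^ j * q ^ (j * (j - 1) div 2)"
    have S: "S \<noteq> 0" using q0 by (simp add: S_def)
    have t: "qpoch (?t ^ n) q j = S * qpoch (q ^ n) ?t j / q ^ (n * j)"
      using qpoch_inverse_power[OF q0, of n j] q0 by (simp add: S_def eq_divide_eq)
    have M: "qpoch M q j = S * qpoch (q ^ N) ?t j * M ^ j"
    proof -
      have "M ^ j * q ^ (N * j) = 1" using q0 by (simp add: M_def power_divide power_mult)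
      then have "qpoch M q j = qpoch M q j * (M ^ j * q ^ (N * j))" by simp
      also have "\<dots> = (qpoch M q j * q ^ (N * j)) * M ^ j" by (simp only: mult_ac)
      finally show ?thesis unfolding M_def S_def qpoch_inverse_power[OF q0] .
    qed
    have nj: "q ^ (n * j) = q ^ (j * j) * q ^ (j * p)"
      by (simp add: n algebra_simps power_add)
    have M0: "M ^ j \<noteq> 0" using q0 by (simp add: M_def)
    have cancel: "S * c / (d * e) / (S * f * g) * (g * d) * e = c / f" if "d \<noteq> 0" "e \<noteq> 0" "g \<noteq> 0" for c d e f g
      using S that by (simp add: divide_simps)
    \<comment> \<open>The power q^(jp) comes from \<open>hpoch_factor\<close>; together with q^(j^2)
      it makes q^(nj), the denominator in \<open>t\<close>.\<close>
    have coeff: "qpoch (?t ^ n) q j / qpoch M q j * (M ^ j * q ^ (j * j)) * q ^ (j * p)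
      = qpoch (q ^ n) ?t j / qpoch (q ^ N) ?t j"
      unfolding t M nj by (rule cancel) (use M0 q0 in auto)
    \<comment> \<open>q-Chu-Vandermonde applies with u = A q^j and c = a q^j, as its denominator is
      a factor of (a;q)_n.\<close>
    have "qpoch (a * q ^ j) q p \<noteq> 0" using a_nz a_split[OF j] n by auto
    then have "(\<Sum>m\<le>p. I j m) = hpoch q (A * q ^ j) (a * q ^ j) p / qpoch (a * q ^ j) q p"
      unfolding I_def n diff_add_inverse by (rule q_chu_vandermonde[OF assms(1,2)])
    then have "(\<Sum>m\<le>n - j. C j * I j m)
      = C j * (hpoch q (A * q ^ j) (a * q ^ j) p / qpoch (a * q ^ j) q p)"
      by (simp add: n flip: sum_distrib_left)
    also have "hpoch q (A * q ^ j) (a * q ^ j) p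
      = q ^ (j * p) * (q ^ (p * (p - 1) div 2) * (- a) ^ p * qpoch (b * q ^ j) q p)"
      unfolding A_def n by (rule hpoch_factor[OF q0])
    also have "C j * (q ^ (j * p) * (q ^ (p * (p - 1) div 2) * (- a) ^ p * qpoch (b * q ^ j) q p)
        / qpoch (a * q ^ j) q p)
      = (qpoch (?t ^ n) q j / qpoch M q j * (M ^ j * q ^ (j * j)) * q ^ (j * p))
        * (q ^ (p * (p - 1) div 2) * (- a) ^ p * qpoch (b * q ^ j) q p * qpoch A q j * qpoch X ?t j
          / (qpoch a q j * qpoch (a * q ^ j) q p * qpoch q q j))"
      unfolding C_def by (simp only: divide_inverse inverse_mult_distrib mult_1_left mult_ac)
    also have "\<dots> = R j"
      unfolding coeff R_def a_split[OF j] unfolding n diff_add_inverse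
      by (simp only: divide_inverse inverse_mult_distrib mult_1_left mult_ac)
    finally show ?thesis .
  qed

  have powi: "q powi (int x - int N) = X * M" "q powi (- int n) = ?t ^ n" "q powi (- int N) = M"
    unfolding X_def M_def
    by (simp_all only: power_int_diff[OF disjI1[OF q0]] power_int_minus power_int_of_nat
        divide_inverse mult_1_left power_inverse)
  have "q_Hahn a b N q n x = (\<Sum>k\<le>n. \<Sum>j\<le>k. C j * I j (k - j))"
    unfolding q_Hahn_def powi A_def[symmetric] atLeast0AtMost
    by (intro sum.cong refl summand) simp
  \<comment> \<open>The triangle j \<le> k \<le> n is reindexed by m = k - j, so that m becomes the
    inner variable.\<close>
  also have "\<dots> = (\<Sum>(j, m)\<in>{(j, m). j + m \<le> n}. C j * I j m)"
    by (rule sum.triangle_reindex_eq[symmetric])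
  also have "{(j, m). j + m \<le> n} = (SIGMA j:{..n}. {..n - j})"
    by auto
  also have "(\<Sum>(j, m)\<in>\<dots>. C j * I j m) = (\<Sum>j\<le>n. \<Sum>m\<le>n - j. C j * I j m)"
    by (rule sum.Sigma[symmetric]) auto
  also have "\<dots> = (\<Sum>j\<le>n. R j)"
    by (intro sum.cong refl inner) auto
  \<comment> \<open>For x < j \<le> n the factor (q^x;1/q)_j makes \<open>R j\<close> zero.\<close>
  also have "\<dots> = (\<Sum>k=0..min n x. R k)"
    by (rule sum.mono_neutral_right) (auto simp: R_def X_def qpoch_power_inverse_base_eq_0[OF q0])
  finally show ?thesis by (simp only: R_def A_def X_def)
qed

end
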